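(* The standard semiring $\mathbb{N}_0$ of nonnegative integers (with usual addition and multiplication) is neither austere nor Kuratowski; however, it is nucleus.
   Context: An ideal of a commutative semiring $S$ is a nonempty subset $I$ with $a+b\in I$ and $sa\in I$ for all $a,b\in I$, $s\in S$. An ideal $I$ is subtractive if $x+y\in I$ and $x\in I$ imply $y\in I$, for all $x,y\in S$. $\operatorname{Id}(S)$ is the lattice of ideals of $S$ ordered by inclusion, with least element $\{0\}$, join $I+J=\{i+j:i\in I,j\in J\}$ and meet $I\cap J$. $\operatorname{scl}_S(I)$ is the intersection of all subtractive ideals of $S$ containing $I$. $S$ is austere if its only subtractive ideals are $\{0\}$ and $S$. A Kuratowski map on a join-semilattice $(P,\le)$ with least element $0$ is a function $k:P\to P$ with $x\le k(x)$, $k(k(x))=k(x)$, $k(0)=0$ and $k(x\vee y)=k(x)\vee k(y)$ for all $x,y\in P$. A nucleus map on a meet-semilattice $(P,\le)$ is a function $\nu:P\to P$ with $x\le\nu(x)$, $\nu(\nu(x))=\nu(x)$ and $\nu(x\wedge y)=\nu(x)\wedge\nu(y)$ for all $x,y\in P$. $S$ is Kuratowski (respectively nucleus) if $\operatorname{scl}_S$ is a Kuratowski map (respectively a nucleus map) on $\operatorname{Id}(S)$. *)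

theory Defs
  imports Main
begin

definition semiring_ideal :: "'a::comm_semiring_1 set \<Rightarrow> bool" where
  "semiring_ideal I \<longleftrightarrow>
     I \<noteq> {} \<and> (\<forall>a\<in>I. \<forall>b\<in>I. a + b \<in> I) \<and> (\<forall>s. \<forall>a\<in>I. s * a \<in> I)"

(* Id(S), where the semiring S is the whole type 'a. *)
typedef (overloaded) 'a Id = "{I :: 'a::comm_semiring_1 set. semiring_ideal I}"
  morphisms set_of_Id Abs_Id
  by (rule exI[of _ UNIV]) (simp add: semiring_ideal_def)

setup_lifting type_definition_Id

lemma semiring_ideal_zero: "semiring_ideal I \<Longrightarrow> 0 \<in> I"
  unfolding semiring_ideal_def by (metis ex_in_conv mult_zero_left)

lemma semiring_ideal_sum:
  assumes "semiring_ideal I" "semiring_ideal J"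
  shows "semiring_ideal {i + j | i j. i \<in> I \<and> j \<in> J}"
  unfolding semiring_ideal_def
proof (intro conjI ballI allI)
  show "{i + j | i j. i \<in> I \<and> j \<in> J} \<noteq> {}"
    using assms by (auto simp: semiring_ideal_def)
next
  fix a b assume "a \<in> {i + j | i j. i \<in> I \<and> j \<in> J}" "b \<in> {i + j | i j. i \<in> I \<and> j \<in> J}"
  then obtain i j i' j' where "a = i + j" "b = i' + j'" "i \<in> I" "j \<in> J" "i' \<in> I" "j' \<in> J"
    by blast
  then have "a + b = (i + i') + (j + j')" "i + i' \<in> I" "j + j' \<in> J"
    using assms by (auto simp: semiring_ideal_def distrib_left add.assoc add.commute add.left_commute)
  then show "a + b \<in> {i + j | i j. i \<in> I \<and> j \<in> J}" by blast
next
  fix s a assume "a \<in> {i + j | i j. i \<in> I \<and> j \<in> J}"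
  then obtain i j where "a = i + j" "i \<in> I" "j \<in> J" by blast
  then have "s * a = s * i + s * j" "s * i \<in> I" "s * j \<in> J"
    using assms by (auto simp: semiring_ideal_def distrib_left add.assoc add.commute add.left_commute)
  then show "s * a \<in> {i + j | i j. i \<in> I \<and> j \<in> J}" by blast
qed

lemma semiring_ideal_Int:
  assumes "semiring_ideal I" "semiring_ideal J"
  shows "semiring_ideal (I \<inter> J)"
proof -
  have "0 \<in> I \<inter> J"
    using assms by (simp add: semiring_ideal_zero)
  then show ?thesis
    using assms unfolding semiring_ideal_def by auto
qed

instantiation Id :: (comm_semiring_1) bounded_lattice
begin

lift_definition less_eq_Id :: "'a Id \<Rightarrow> 'a Id \<Rightarrow> bool" is "(\<subseteq>)" .

lift_definition less_Id :: "'a Id \<Rightarrow> 'a Id \<Rightarrow> bool" is "(\<subset>)" .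

lift_definition bot_Id :: "'a Id" is "{0}"
  by (simp add: semiring_ideal_def)

lift_definition top_Id :: "'a Id" is UNIV
  by (simp add: semiring_ideal_def)

lift_definition sup_Id :: "'a Id \<Rightarrow> 'a Id \<Rightarrow> 'a Id"
  is "\<lambda>I J. {i + j | i j. i \<in> I \<and> j \<in> J}"
  by (rule semiring_ideal_sum)

lift_definition inf_Id :: "'a Id \<Rightarrow> 'a Id \<Rightarrow> 'a Id" is "(\<inter>)"
  by (rule semiring_ideal_Int)

instance
proof
  fix x y z :: "'a Id"
  show "x \<le> sup x y"
    by transfer (metis (mono_tags, lifting) add.right_neutral mem_Collect_eq semiring_ideal_zero subsetI)
  show "y \<le> sup x y"
    by transfer (metis (mono_tags, lifting) add.left_neutral mem_Collect_eq semiring_ideal_zero subsetI)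
  show "y \<le> x \<Longrightarrow> z \<le> x \<Longrightarrow> sup y z \<le> x"
    by transfer (auto simp: semiring_ideal_def)
  show "bot \<le> x"
    by transfer (simp add: semiring_ideal_zero)
qed (transfer; auto)+

end

definition subtractive :: "'a::comm_semiring_1 Id \<Rightarrow> bool" where
  "subtractive I \<longleftrightarrow>
     (\<forall>x y. x + y \<in> set_of_Id I \<and> x \<in> set_of_Id I \<longrightarrow> y \<in> set_of_Id I)"

lemma semiring_ideal_INT: "semiring_ideal (\<Inter>J\<in>A. set_of_Id J)"
proof -
  have I: "semiring_ideal (set_of_Id J)" for J :: "'a Id"
    using set_of_Id by blast
  then have "0 \<in> (\<Inter>J\<in>A. set_of_Id J)"
    by (simp add: semiring_ideal_zero)
  then show ?thesis
    using I unfolding semiring_ideal_def by auto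
qed

lift_definition scl :: "'a::comm_semiring_1 Id \<Rightarrow> 'a Id"
  is "\<lambda>I. \<Inter>J\<in>{J. subtractive J \<and> I \<subseteq> set_of_Id J}. set_of_Id J"
  by (rule semiring_ideal_INT)

definition austere :: "'a::comm_semiring_1 itself \<Rightarrow> bool" where
  "austere _ \<longleftrightarrow> {I :: 'a Id. subtractive I} = {bot, top}"

definition Kuratowski_map :: "('p::bounded_semilattice_sup_bot \<Rightarrow> 'p) \<Rightarrow> bool" where
  "Kuratowski_map k \<longleftrightarrow>
     (\<forall>x. x \<le> k x) \<and> (\<forall>x. k (k x) = k x) \<and> k bot = bot \<and>
     (\<forall>x y. k (sup x y) = sup (k x) (k y))"

definition nucleus_map :: "('p::semilattice_inf \<Rightarrow> 'p) \<Rightarrow> bool" where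
  "nucleus_map \<nu> \<longleftrightarrow>
     (\<forall>x. x \<le> \<nu> x) \<and> (\<forall>x. \<nu> (\<nu> x) = \<nu> x) \<and>
     (\<forall>x y. \<nu> (inf x y) = inf (\<nu> x) (\<nu> y))"

definition Kuratowski :: "'a::comm_semiring_1 itself \<Rightarrow> bool" where
  "Kuratowski _ \<longleftrightarrow> Kuratowski_map (scl :: 'a Id \<Rightarrow> 'a Id)"

definition nucleus :: "'a::comm_semiring_1 itself \<Rightarrow> bool" where
  "nucleus _ \<longleftrightarrow> nucleus_map (scl :: 'a Id \<Rightarrow> 'a Id)"

end

theory Submission imports Defs begin

text \<open>
  In any commutative semiring the subtractive closure of an ideal \<open>I\<close> consists of the \<open>x\<close> such that
  \<open>a + x \<in> I\<close> for some \<open>a \<in> I\<close>. For natural numbers such an \<open>x\<close> has all its multiples \<open>k * x\<close>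
  with \<open>k\<close> large in \<open>I\<close>. Hence if \<open>x\<close> lies in the closures of \<open>I\<close> and \<open>J\<close>, then
  \<open>k * x\<close> and \<open>k * x + x\<close> lie in \<open>I \<inter> J\<close> for some \<open>k\<close>, so that \<open>x\<close> lies in the closure of \<open>I \<inter> J\<close>.
  The ideals generated by 2 and 3 are subtractive, whereas their sum does not contain 1 but
  has 1 in its closure.
\<close>

lemma semiring_ideal_set_of_Id: "semiring_ideal (set_of_Id I)"
  using set_of_Id by blast

lemma Id_zero: "0 \<in> set_of_Id I"
  by (simp add: semiring_ideal_set_of_Id semiring_ideal_zero)

lemma Id_add: "a \<in> set_of_Id I \<Longrightarrow> b \<in> set_of_Id I \<Longrightarrow> a + b \<in> set_of_Id I"
  using semiring_ideal_set_of_Id unfolding semiring_ideal_def by blast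

lemma Id_mult: "a \<in> set_of_Id I \<Longrightarrow> s * a \<in> set_of_Id I"
  using semiring_ideal_set_of_Id unfolding semiring_ideal_def by blast

lift_definition subtractive_hull :: "'a::comm_semiring_1 Id \<Rightarrow> 'a Id"
  is "\<lambda>I. {x. \<exists>a\<in>I. a + x \<in> I}"
proof -
  fix I :: "'a set"
  assume I: "semiring_ideal I"
  have add: "\<And>a b. a \<in> I \<Longrightarrow> b \<in> I \<Longrightarrow> a + b \<in> I"
    and mult: "\<And>s a. a \<in> I \<Longrightarrow> s * a \<in> I"
    using I by (auto simp: semiring_ideal_def)
  show "semiring_ideal {x. \<exists>a\<in>I. a + x \<in> I}"
    unfolding semiring_ideal_def
  proof (intro conjI ballI allI)
    show "{x. \<exists>a\<in>I. a + x \<in> I} \<noteq> {}"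
      using semiring_ideal_zero[OF I] by force
  next
    fix x y assume "x \<in> {x. \<exists>a\<in>I. a + x \<in> I}" "y \<in> {x. \<exists>a\<in>I. a + x \<in> I}"
    then obtain a b where ab: "a \<in> I" "a + x \<in> I" "b \<in> I" "b + y \<in> I" by blast
    have "(a + b) + (x + y) = (a + x) + (b + y)" by (simp add: ac_simps)
    then have "(a + b) + (x + y) \<in> I"
      using add[OF ab(2,4)] by metis
    then show "x + y \<in> {x. \<exists>a\<in>I. a + x \<in> I}"
      using add[OF ab(1,3)] by blast
  next
    fix s x assume "x \<in> {x. \<exists>a\<in>I. a + x \<in> I}"
    then obtain a where "a \<in> I" "a + x \<in> I" by blast
    then have "s * a \<in> I" "s * a + s * x \<in> I"
      using mult by (auto simp flip: distrib_left)
    then show "s * x \<in> {x. \<exists>a\<in>I. a + x \<in> I}" by blast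
  qed
qed

text \<open>If \<open>a\<close> witnesses \<open>x\<close> and \<open>b\<close> witnesses
  \<open>x + y\<close>, then \<open>a + x + b\<close> witnesses \<open>y\<close>.\<close>

lemma subtractive_subtractive_hull: "subtractive (subtractive_hull I)"
  unfolding subtractive_def
proof (intro allI impI, elim conjE)
  fix x y
  assume "x + y \<in> set_of_Id (subtractive_hull I)" "x \<in> set_of_Id (subtractive_hull I)"
  then obtain a b where ab: "a \<in> set_of_Id I" "a + x \<in> set_of_Id I"
      "b \<in> set_of_Id I" "b + (x + y) \<in> set_of_Id I"
    by (auto simp: subtractive_hull.rep_eq)
  have "(a + x + b) + y = a + (b + (x + y))" by (simp add: ac_simps)
  then have "a + x + b \<in> set_of_Id I" "(a + x + b) + y \<in> set_of_Id I"
    using ab by (auto intro: Id_add)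
  then show "y \<in> set_of_Id (subtractive_hull I)"
    by (auto simp: subtractive_hull.rep_eq)
qed

text \<open>The hull is one of the subtractive ideals being intersected; conversely, every
  subtractive ideal above \<open>I\<close> contains \<open>a\<close> and \<open>a + x\<close>, hence
  \<open>x\<close>.\<close>

lemma mem_scl_iff:
  "x \<in> set_of_Id (scl I) \<longleftrightarrow> (\<exists>a\<in>set_of_Id I. a + x \<in> set_of_Id I)"
proof
  assume "x \<in> set_of_Id (scl I)"
  moreover have "set_of_Id I \<subseteq> set_of_Id (subtractive_hull I)"
    by (auto simp: subtractive_hull.rep_eq intro: Id_add)
  ultimately have "x \<in> set_of_Id (subtractive_hull I)"
    using subtractive_subtractive_hull by (auto simp: scl.rep_eq)
  then show "\<exists>a\<in>set_of_Id I. a + x \<in> set_of_Id I"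
    by (simp add: subtractive_hull.rep_eq)
next
  assume "\<exists>a\<in>set_of_Id I. a + x \<in> set_of_Id I"
  then have "x \<in> set_of_Id J" if "subtractive J" "set_of_Id I \<subseteq> set_of_Id J" for J
    using that unfolding subtractive_def by blast
  then show "x \<in> set_of_Id (scl I)"
    by (simp add: scl.rep_eq)
qed

lemma le_scl: "I \<le> scl I"
  by transfer auto

lemma scl_least: "subtractive J \<Longrightarrow> I \<le> J \<Longrightarrow> scl I \<le> J"
  by (auto simp: less_eq_Id.rep_eq scl.rep_eq)

lemma scl_eq: "subtractive I \<Longrightarrow> scl I = I"
  by (simp add: antisym le_scl scl_least)

lemma scl_mono: "I \<le> J \<Longrightarrow> scl I \<le> scl J"
  by (auto simp: less_eq_Id.rep_eq scl.rep_eq)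

text \<open>Subtractivity survives intersections; with \<open>scl_eq\<close> this makes
  \<open>scl\<close> idempotent.\<close>

lemma subtractive_scl: "subtractive (scl I)"
  unfolding subtractive_def scl.rep_eq by (blast dest: subtractive_def[THEN iffD1])

text \<open>Division with remainder, \<open>k = q * a + t\<close>, gives k x = (q x - t) a + t (a +
  x), a combination of elements of \<open>I\<close> as soon as t \<le> q x. The bound on
  \<open>k\<close> ensures this, since then t < a \<le> q.\<close>

lemma eventually_multiples_in_Id:
  fixes a x :: nat
  assumes "a \<in> set_of_Id I" "a + x \<in> set_of_Id I" "k \<ge> a * a"
  shows "k * x \<in> set_of_Id I"
\<comment> \<open>Division needs a positive \<open>a\<close>, and q \<le> q x needs a positive
  \<open>x\<close>.\<close>
proof (cases "a = 0 \<or> x = 0")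
  case True
  then show ?thesis
    using assms Id_mult[of x I k] by (auto simp: Id_zero)
next
  case False
  define q t where "q = k div a" and "t = k mod a"
  have k: "k = q * a + t" and "t < a"
    using False by (simp_all add: q_def t_def)
  have "a \<le> q"
    using False assms(3) by (simp add: q_def less_eq_div_iff_mult_less_eq)
  also have "q \<le> q * x" using False by simp
  finally obtain m where m: "q * x = t + m"
    using \<open>t < a\<close> by (metis le_trans less_imp_le_nat nat_le_iff_add)
  have "k * x = (q * x) * a + t * x"
    by (simp add: k algebra_simps)
  also have "\<dots> = m * a + t * (a + x)"
    unfolding m by (simp add: algebra_simps)
  finally show ?thesis
    using assms(1,2) by (simp add: Id_add Id_mult)
qed

lemma scl_inf_nat: "scl (inf I J) = inf (scl I) (scl (J :: nat Id))"
proof (rule antisym)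
  show "scl (inf I J) \<le> inf (scl I) (scl J)"
    by (simp add: scl_mono)
  show "inf (scl I) (scl J) \<le> scl (inf I J)"
    unfolding less_eq_Id.rep_eq
  proof
    fix x assume "x \<in> set_of_Id (inf (scl I) (scl J))"
    then obtain a b where a: "a \<in> set_of_Id I" "a + x \<in> set_of_Id I"
      and b: "b \<in> set_of_Id J" "b + x \<in> set_of_Id J"
      by (auto simp: inf_Id.rep_eq mem_scl_iff)
    \<comment> \<open>The sum exceeds both thresholds, so one \<open>k\<close> serves
      \<open>I\<close> and \<open>J\<close>.\<close>
    define k where "k = a * a + b * b"
    have "l * x \<in> set_of_Id (inf I J)" if "l \<ge> k" for l
      using that a b eventually_multiples_in_Id by (simp add: inf_Id.rep_eq k_def)
    \<comment> \<open>Two consecutive multiples differ by \<open>x\<close>, so \<open>k * x\<close>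
      is the witness for \<open>mem_scl_iff\<close>.\<close>
    from this[of k] this[of "Suc k"]
    have "k * x \<in> set_of_Id (inf I J)" "k * x + x \<in> set_of_Id (inf I J)"
      by (simp_all add: add.commute)
    then show "x \<in> set_of_Id (scl (inf I J))"
      by (auto simp: mem_scl_iff)
  qed
qed

lift_definition principal_Id :: "'a::comm_semiring_1 \<Rightarrow> 'a Id"
  is "\<lambda>d. {n. d dvd n}"
  by (auto simp: semiring_ideal_def)

text \<open>Cancellation lets divisibility pass from a sum and one summand to the other
  summand.\<close>

lemma subtractive_principal_Id:
  "subtractive (principal_Id (d :: 'a::comm_semiring_1_cancel))"
  by (auto simp: subtractive_def principal_Id.rep_eq dvd_add_right_iff)

text \<open>The even numbers are subtractive, nonzero because of 2 and proper because of 1.\<close>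

lemma not_austere_nat: "\<not> austere TYPE(nat)"
proof
  assume "austere TYPE(nat)"
  then have "principal_Id (2 :: nat) \<in> {bot, top}"
    using subtractive_principal_Id unfolding austere_def by blast
  then have "{n :: nat. 2 dvd n} = {0} \<or> {n :: nat. 2 dvd n} = UNIV"
    by (auto simp flip: set_of_Id_inject simp: principal_Id.rep_eq bot_Id.rep_eq top_Id.rep_eq)
  moreover have "(2 :: nat) \<in> {n. 2 dvd n}" "(1 :: nat) \<notin> {n. 2 dvd n}"
    by auto
  ultimately show False
    by (metis UNIV_I singletonD zero_neq_numeral)
qed

lemma not_Kuratowski_nat: "\<not> Kuratowski TYPE(nat)"
proof
  assume "Kuratowski TYPE(nat)"
  \<comment> \<open>Since \<open>scl\<close> fixes both summands, preservation of joins would make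
    it fix their sum.\<close>
  then have eq: "scl (sup (principal_Id 2) (principal_Id (3 :: nat)))
      = sup (principal_Id 2) (principal_Id 3)"
    by (simp add: Kuratowski_def Kuratowski_map_def scl_eq subtractive_principal_Id)
  have sup: "set_of_Id (sup (principal_Id 2) (principal_Id (3 :: nat)))
      = {i + j | i j. 2 dvd i \<and> 3 dvd j}"
    by (simp add: sup_Id.rep_eq principal_Id.rep_eq)
  have "2 \<in> {i + j | i j. (2 :: nat) dvd i \<and> 3 dvd j}"
    by (rule CollectI, rule exI[of _ 2], rule exI[of _ 0]) simp
  moreover have "3 \<in> {i + j | i j. (2 :: nat) dvd i \<and> 3 dvd j}"
    by (rule CollectI, rule exI[of _ 0], rule exI[of _ 3]) simp
  ultimately have "1 \<in> set_of_Id (scl (sup (principal_Id 2) (principal_Id (3 :: nat))))"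
    unfolding mem_scl_iff sup by (intro bexI[of _ 2]) (simp_all only: numeral_plus_one semiring_norm)
  then obtain i j :: nat where "1 = i + j" "2 dvd i" "3 dvd j"
    unfolding eq sup by blast
  \<comment> \<open>One of \<open>i\<close> and \<open>j\<close> would have to be 1, which neither 2
    nor 3 divides.\<close>
  then show False by presburger
qed

lemma nucleus_nat: "nucleus TYPE(nat)"
  by (simp add: nucleus_def nucleus_map_def le_scl scl_inf_nat scl_eq subtractive_scl)

theorem theorem4p17:
  "\<not> austere TYPE(nat) \<and> \<not> Kuratowski TYPE(nat) \<and> nucleus TYPE(nat)"
  by (simp add: not_austere_nat not_Kuratowski_nat nucleus_nat)

end
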